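(* Let $n\ge1$ and $x,y$ coprime with $1\le x<y$, consider the rotor multigraph $P^{x,y}_n$, let $F=\sum_{i=0}^n x^{n-i}y^i$, and let $\bar h:\Sigma\to\mathbb{Z}/F\mathbb{Z}$ and $\bar g:\mathcal{R}\to\mathbb{Z}/F\mathbb{Z}$ be $h$ and $g$ reduced modulo $F$. Then: (i) the Sandpile Group $SP(P^{x,y}_n)$ is cyclic of order $F$; (ii) $\bar h$ induces a well-defined map on $\Sigma/\!\sim_S$ which is a group isomorphism between $SP(P^{x,y}_n)$ and $\mathbb{Z}/F\mathbb{Z}$; (iii) $\bar g$ induces a well-defined map on rotor equivalence classes $\mathcal{R}/\!\sim$ which is a bijection onto $\mathbb{Z}/F\mathbb{Z}$; (iv) for every rotor-particle configuration $(\rho,\sigma)$ and every $(\rho',\sigma')\in\mathrm{routing}^\infty(\rho,\sigma)$, we have $\bar g(\rho')=\bar g(\rho)-\bar h(\sigma)$.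
   Context: The path multigraph $P^{x,y}_n$ has vertices $u_0,\dots,u_{n+1}$; $u_0,u_{n+1}$ are sinks and $V_0=\{u_1,\dots,u_n\}$. For $k\in\{1,\dots,n\}$, $u_k$ has outgoing arcs $a^k_0,\dots,a^k_{x+y-1}$, where $a^k_i$ goes to $u_{k+1}$ for $0\le i\le x-1$ and to $u_{k-1}$ for $x\le i\le x+y-1$; the rotor order is $\theta(a^k_i)=a^k_{(i+1)\bmod (x+y)}$. A rotor configuration assigns to each $u\in V_0$ an outgoing arc $\rho(u)$; $\mathcal{R}$ is their set. Particle configurations are maps $\sigma:\{u_0,\dots,u_{n+1}\}\to\mathbb{Z}$, forming the group $\Sigma$; a vertex $u$ is identified with the configuration with one particle on $u$. For $u\in V_0$, $\mathrm{routing}^+_u(\rho,\sigma)=(\rho',\sigma+\mathrm{head}(\rho(u))-u)$ with $\rho'$ equal to $\rho$ except $\rho'(u)=\theta(\rho(u))$; these are commuting bijections; for $r:V_0\to\mathbb{Z}$, $\mathrm{routing}^r$ composes the $(\mathrm{routing}^+_u)^{r(u)}$ (negative powers = inverse). $(\rho,\sigma)\sim(\rho',\sigma')$ iff $\mathrm{routing}^r(\rho,\sigma)=(\rho',\sigma')$ for some $r$. Rotor configurations: $\rho\sim\rho'$ iff $(\rho,\sigma)\sim(\rho',\sigma)$ for some $\sigma\in\Sigma$. Particle configurations: $\sigma\sim\sigma'$ iff $(\rho,\sigma)\sim(\rho,\sigma')$ for some $\rho\in\mathcal{R}$; and $\sigma\sim_S\sigma'$ iff there is $\sigma_1\sim\sigma$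 with $\sigma_1(u)=\sigma'(u)$ for all $u\in V_0$. The Sandpile Group $SP(P^{x,y}_n)$ is the quotient $\Sigma/\!\sim_S$ with the addition inherited from $\Sigma$. $\mathrm{routing}^\infty(\rho,\sigma)$ is the set of $(\rho',\sigma')\sim(\rho,\sigma)$ with $\sigma'(u)=0$ for all $u\in V_0$. The function $h:\Sigma\to\mathbb{Z}$ is linear with $h(u_0)=0$ and $h(u_k)=\sum_{i=0}^{k-1}x^{n-i}y^i$ for $1\le k\le n+1$. The function $g$ is defined on arcs by $g(a^k_j)=\sum_{i=0}^{j-1}\big(h(\mathrm{head}(a^k_i))-h(u_k)\big)$ (so $g(a^k_0)=0$), and $g(\rho)=\sum_{u\in V_0}g(\rho(u))$. *)

theory Defs
  imports "Graph_Theory.Digraph" "HOL-Algebra.Elementary_Groups" "HOL-Algebra.Product_Groups"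
begin

record ('v, 'a) rotor_graph = "('v, 'a) pre_digraph" +
  sinks :: "'v set"
  next_rotor :: "'a \<Rightarrow> 'a"

definition nonsinks :: "('v, 'a) rotor_graph \<Rightarrow> 'v set" where
  "nonsinks G = verts G - sinks G"

definition rotor_configs :: "('v, 'a) rotor_graph \<Rightarrow> ('v \<Rightarrow> 'a) set" where
  "rotor_configs G = (\<Pi>\<^sub>E u \<in> nonsinks G. out_arcs (pre_digraph.truncate G) u)"

definition particle_group :: "('v, 'a) rotor_graph \<Rightarrow> ('v \<Rightarrow> int) monoid" where
  "particle_group G = product_group (verts G) (\<lambda>_. integer_group)"

abbreviation particle_configs :: "('v, 'a) rotor_graph \<Rightarrow> ('v \<Rightarrow> int) set" where
  "particle_configs G \<equiv> carrier (particle_group G)"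

definition one_particle :: "('v, 'a) rotor_graph \<Rightarrow> 'v \<Rightarrow> 'v \<Rightarrow> int" where
  "one_particle G u = (\<lambda>v \<in> verts G. if v = u then 1 else 0)"

type_synonym ('v, 'a) rotor_particle = "('v \<Rightarrow> 'a) \<times> ('v \<Rightarrow> int)"

definition rp_configs :: "('v, 'a) rotor_graph \<Rightarrow> ('v, 'a) rotor_particle set" where
  "rp_configs G = rotor_configs G \<times> particle_configs G"

text \<open>
  A bijection of the set of rotor-particle configurations is extended by the identity to the
  whole type, so that its inverse is \<open>inv_into UNIV\<close> and commutation holds as an equality of functions.
\<close>

definition routing_plus ::
  "('v, 'a) rotor_graph \<Rightarrow> 'v \<Rightarrow> ('v, 'a) rotor_particle \<Rightarrow> ('v, 'a) rotor_particle" where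
  "routing_plus G u c =
     (if c \<in> rp_configs G then
        (case c of (\<rho>, \<sigma>) \<Rightarrow>
           (\<rho>(u := next_rotor G (\<rho> u)),
            \<lambda>v \<in> verts G. \<sigma> v + one_particle G (head G (\<rho> u)) v - one_particle G u v))
      else c)"

definition int_funpow :: "('b \<Rightarrow> 'b) \<Rightarrow> int \<Rightarrow> 'b \<Rightarrow> 'b" where
  "int_funpow f k = (if 0 \<le> k then f ^^ nat k else (inv_into UNIV f) ^^ nat (- k))"

text \<open>
  The order in which \<^const>\<open>Finite_Set.fold\<close> visits the vertices is irrelevant because routings at
  different vertices commute. Only the values of the routing vector on the non-sinks are used.
\<close>

definition routing ::
  "('v, 'a) rotor_graph \<Rightarrow> ('v \<Rightarrow> int) \<Rightarrow> ('v, 'a) rotor_particle \<Rightarrow> ('v, 'a) rotor_particle" where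
  "routing G r c = Finite_Set.fold (\<lambda>u. int_funpow (routing_plus G u) (r u)) c (nonsinks G)"

definition rp_equiv :: "('v, 'a) rotor_graph \<Rightarrow> ('v, 'a) rotor_particle rel" where
  "rp_equiv G = {(c, c'). c \<in> rp_configs G \<and> c' \<in> rp_configs G \<and> (\<exists>r. routing G r c = c')}"

definition rotor_equiv :: "('v, 'a) rotor_graph \<Rightarrow> ('v \<Rightarrow> 'a) rel" where
  "rotor_equiv G = {(\<rho>, \<rho>'). \<rho> \<in> rotor_configs G \<and> \<rho>' \<in> rotor_configs G \<and>
     (\<exists>\<sigma> \<in> particle_configs G. ((\<rho>, \<sigma>), (\<rho>', \<sigma>)) \<in> rp_equiv G)}"

definition particle_equiv :: "('v, 'a) rotor_graph \<Rightarrow> ('v \<Rightarrow> int) rel" where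
  "particle_equiv G = {(\<sigma>, \<sigma>'). \<sigma> \<in> particle_configs G \<and> \<sigma>' \<in> particle_configs G \<and>
     (\<exists>\<rho> \<in> rotor_configs G. ((\<rho>, \<sigma>), (\<rho>, \<sigma>')) \<in> rp_equiv G)}"

definition sink_equiv :: "('v, 'a) rotor_graph \<Rightarrow> ('v \<Rightarrow> int) rel" where
  "sink_equiv G = {(\<sigma>, \<sigma>'). \<sigma> \<in> particle_configs G \<and> \<sigma>' \<in> particle_configs G \<and>
     (\<exists>\<sigma>\<^sub>1. (\<sigma>, \<sigma>\<^sub>1) \<in> particle_equiv G \<and> (\<forall>u \<in> nonsinks G. \<sigma>\<^sub>1 u = \<sigma>' u))}"

definition routing_infty ::
  "('v, 'a) rotor_graph \<Rightarrow> ('v, 'a) rotor_particle \<Rightarrow> ('v, 'a) rotor_particle set" where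
  "routing_infty G c = {(\<rho>', \<sigma>'). (c, (\<rho>', \<sigma>')) \<in> rp_equiv G \<and> (\<forall>u \<in> nonsinks G. \<sigma>' u = 0)}"

definition sandpile_group :: "('v, 'a) rotor_graph \<Rightarrow> ('v \<Rightarrow> int) set monoid" where
  "sandpile_group G =
     \<lparr>carrier = particle_configs G // sink_equiv G,
      monoid.mult = (\<lambda>X Y. \<Union>\<sigma> \<in> X. \<Union>\<tau> \<in> Y. sink_equiv G `` {\<sigma> \<otimes>\<^bsub>particle_group G\<^esub> \<tau>}),
      one = sink_equiv G `` {\<one>\<^bsub>particle_group G\<^esub>}\<rparr>"

text \<open>The vertex \<open>u\<^sub>k\<close> is encoded as \<open>k\<close>, the \<open>i\<close>-th arc leaving it as \<open>(k, i)\<close>.\<close>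

definition path_graph :: "nat \<Rightarrow> nat \<Rightarrow> nat \<Rightarrow> (nat, nat \<times> nat) rotor_graph" where
  "path_graph n x y =
     \<lparr>verts = {0..n + 1},
      arcs = {1..n} \<times> {0..<x + y},
      tail = fst,
      head = (\<lambda>(k, i). if i < x then k + 1 else k - 1),
      sinks = {0, n + 1},
      next_rotor = (\<lambda>(k, i). (k, (i + 1) mod (x + y)))\<rparr>"

definition path_order :: "nat \<Rightarrow> nat \<Rightarrow> nat \<Rightarrow> nat" where
  "path_order n x y = (\<Sum>i = 0..n. x ^ (n - i) * y ^ i)"

text \<open>The value of \<open>h\<close> on the configuration with one particle on \<open>u\<^sub>k\<close>; for \<open>k = 0\<close> it is 0.\<close>

definition vertex_h :: "nat \<Rightarrow> nat \<Rightarrow> nat \<Rightarrow> nat \<Rightarrow> int" where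
  "vertex_h n x y k = (\<Sum>i<k. int x ^ (n - i) * int y ^ i)"

definition path_h :: "nat \<Rightarrow> nat \<Rightarrow> nat \<Rightarrow> (nat \<Rightarrow> int) \<Rightarrow> int" where
  "path_h n x y \<sigma> = (\<Sum>k \<in> verts (path_graph n x y). \<sigma> k * vertex_h n x y k)"

definition arc_g :: "nat \<Rightarrow> nat \<Rightarrow> nat \<Rightarrow> nat \<times> nat \<Rightarrow> int" where
  "arc_g n x y = (\<lambda>(k, j).
     \<Sum>i<j. vertex_h n x y (head (path_graph n x y) (k, i)) - vertex_h n x y k)"

definition path_g :: "nat \<Rightarrow> nat \<Rightarrow> nat \<Rightarrow> (nat \<Rightarrow> nat \<times> nat) \<Rightarrow> int" where
  "path_g n x y \<rho> = (\<Sum>u \<in> nonsinks (path_graph n x y). arc_g n x y (\<rho> u))"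

definition path_h_mod :: "nat \<Rightarrow> nat \<Rightarrow> nat \<Rightarrow> (nat \<Rightarrow> int) \<Rightarrow> int" where
  "path_h_mod n x y \<sigma> = path_h n x y \<sigma> mod int (path_order n x y)"

definition path_g_mod :: "nat \<Rightarrow> nat \<Rightarrow> nat \<Rightarrow> (nat \<Rightarrow> nat \<times> nat) \<Rightarrow> int" where
  "path_g_mod n x y \<rho> = path_g n x y \<rho> mod int (path_order n x y)"

end

theory Submission
  imports Defs
begin

text \<open>
  Every routing preserves the number of particles and the integer \<open>g(\<rho>) - h(\<sigma>)\<close>, and these two
  invariants are complete: since \<open>x\<close> and \<open>y\<close> are coprime, a family of net edge currents
  of total weight \<open>\<Sum>\<^sub>k f\<^sub>k x\<^bsup>n-k\<^esup> y\<^sup>k = 0\<close> is realised by full turns of the rotors. Hence \<open>\<sim>\<^sub>S\<close> is equality of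
  \<open>h\<close> modulo \<open>F = h(u\<^sub>n\<^sub>+\<^sub>1)\<close>, and rotor equivalence is equality of \<open>g\<close> in the integers. Two values of \<open>g\<close>
  congruent modulo \<open>F\<close> are equal, because a nonzero constant current along the whole path contradicts
  monotonicity of the rotors. All residues occur: routing one particle from \<open>u\<^sub>n\<close> to a sink changes
  \<open>g\<close> by \<open>y\<^sup>n\<close> modulo \<open>F\<close>, which generates the integers modulo \<open>F\<close>.
\<close>

section \<open>Signed arc counts, edge weights and currents of weight zero\<close>

text \<open>
  The position of a rotor is lifted to an integer \<open>p\<close>; \<open>ups x y p\<close> and \<open>downs x y p\<close> count, with sign,
  the arcs to the right and to the left among the first \<open>p\<close> ones.
\<close>

definition ups :: "nat \<Rightarrow> nat \<Rightarrow> int \<Rightarrow> int" where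
  "ups x y p = int x * (p div int (x + y)) + min (p mod int (x + y)) (int x)"

definition downs :: "nat \<Rightarrow> nat \<Rightarrow> int \<Rightarrow> int" where
  "downs x y p = p - ups x y p"

text \<open>The increment of \<open>vertex_h\<close> along the edge from \<open>k\<close> to
  \<open>k + 1\<close>: a particle crossing that edge to the right raises h by this amount.\<close>

definition path_weight :: "nat \<Rightarrow> nat \<Rightarrow> nat \<Rightarrow> nat \<Rightarrow> int" where
  "path_weight n x y k = int x ^ (n - k) * int y ^ k"

text \<open>All weights but the last are divisible by \<open>x\<close>, and the last is a power of
  \<open>y\<close>, so coprimality forces \<open>x\<close> to divide the last coefficient. Carrying
  its quotient one edge to the left shortens the path. In the application, \<open>q k\<close> counts
  full turns of the rotor of the \<open>k\<close>-th vertex, each sending \<open>x\<close> particles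
  right and \<open>y\<close> left.\<close>

lemma coprime_flow_decomposition:
  fixes f :: "nat \<Rightarrow> int"
  assumes "coprime x y" "0 < x" "(\<Sum>k\<le>n. f k * path_weight n x y k) = 0"
  shows "\<exists>q. q 0 = 0 \<and> q (Suc n) = 0 \<and> (\<forall>k\<le>n. f k = int x * q k - int y * q (Suc k))"
  using assms(3)
proof (induction n arbitrary: f)
  case 0
  then show ?case by (intro exI[of _ "\<lambda>_. 0"]) (auto simp: path_weight_def)
next
  case (Suc n)
  have w: "path_weight (Suc n) x y k = int x * path_weight n x y k" if "k \<le> n" for k
    using that by (simp add: path_weight_def Suc_diff_le)
  have split: "int x * (\<Sum>k\<le>n. f k * path_weight n x y k) + f (Suc n) * int y ^ Suc n = 0"
  proof -
    have "path_weight (Suc n) x y (Suc n) = int y ^ Suc n"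
      by (simp add: path_weight_def)
    then show ?thesis
      using Suc.prems by (simp add: w sum_distrib_left mult_ac)
  qed
  then have "int x dvd f (Suc n) * int y ^ Suc n"
    by (metis dvd_add_right_iff dvd_0_right dvd_triv_left)
  moreover have "coprime (int x) (int y ^ Suc n)"
    using assms(1) by simp
  ultimately obtain t where t: "f (Suc n) = int x * t"
    by (metis coprime_dvd_mult_left_iff dvdE)
  \<comment> \<open>The product of \<open>x\<close> and the last weight equals that of
    \<open>y\<close> and the weight before it, so \<open>x * t\<close> units of current on the last
    edge weigh as much as \<open>y * t\<close> on edge \<open>n\<close>.\<close>
  define f' where "f' = f(n := f n + t * int y)"
  have "(\<Sum>k\<le>n. f' k * path_weight n x y k) =
      (\<Sum>k\<le>n. f k * path_weight n x y k + (if k = n then t * int y * path_weight n x y n else 0))"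
    by (rule sum.cong) (auto simp: f'_def algebra_simps)
  also have "\<dots> = (\<Sum>k\<le>n. f k * path_weight n x y k) + t * int y ^ Suc n"
    by (simp add: sum.distrib path_weight_def)
  also have "int x * \<dots> = 0"
    using split t by (simp add: algebra_simps)
  finally have "(\<Sum>k\<le>n. f' k * path_weight n x y k) = 0"
    using assms(2) by simp
  from Suc.IH[OF this] obtain q where q: "q 0 = 0" "q (Suc n) = 0"
    "\<And>k. k \<le> n \<Longrightarrow> f' k = int x * q k - int y * q (Suc k)"
    by auto
  \<comment> \<open>The transfer is undone by replacing the boundary value
    \<open>q (Suc n) = 0\<close> by \<open>t\<close>; the new boundary zero sits one place further
    right.\<close>
  have "f k = int x * (q(Suc n := t, Suc (Suc n) := 0)) k
      - int y * (q(Suc n := t, Suc (Suc n) := 0)) (Suc k)" if "k \<le> Suc n" for k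
    using that q(3)[of k] q(2) t by (cases "k = Suc n"; cases "k = n") (auto simp: f'_def algebra_simps)
  then show ?case
    using q(1) by (intro exI[of _ "q(Suc n := t, Suc (Suc n) := 0)"]) auto
qed

section \<open>Auxiliary facts on quotients, groups and integer division\<close>

text \<open>The product in \<open>sandpile_group\<close> is a union over all pairs of
  representatives; it collapses to one class once that class does not depend on the pair.\<close>

lemma UN_UN_eq_const:
  assumes "s \<in> X" "t \<in> Y" "\<And>a b. a \<in> X \<Longrightarrow> b \<in> Y \<Longrightarrow> f a b = C"
  shows "(\<Union>a\<in>X. \<Union>b\<in>Y. f a b) = C"
  using assms by blast

text \<open>Serves both quotients: an invariant \<open>f\<close> whose level sets are the classes
  has a singleton image on each class, and the element of that image is the induced value.\<close>

lemma ex_bij_betw_quotient_kernel: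
  assumes "R = {(a, b). a \<in> A \<and> b \<in> A \<and> f a = f b}" "f ` A = B"
  shows "\<exists>\<phi>. bij_betw \<phi> (A // R) B \<and> (\<forall>a\<in>A. \<phi> (R `` {a}) = f a)"
proof (intro exI conjI ballI)
  show val: "the_elem (f ` (R `` {a})) = f a" if "a \<in> A" for a
  proof -
    have "f ` (R `` {a}) = {f a}"
      using that assms(1) by auto
    then show ?thesis by simp
  qed
  have "inj_on (\<lambda>X. the_elem (f ` X)) (A // R)"
  proof (rule inj_onI)
    fix X Y assume "X \<in> A // R" "Y \<in> A // R" "the_elem (f ` X) = the_elem (f ` Y)"
    moreover from this obtain a b where "a \<in> A" "b \<in> A" "X = R `` {a}" "Y = R `` {b}"
      by (auto elim!: quotientE)
    ultimately have "f a = f b"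
      by (simp add: val)
    then show "X = Y"
      using assms(1) \<open>a \<in> A\<close> \<open>b \<in> A\<close> \<open>X = R `` {a}\<close> \<open>Y = R `` {b}\<close> by auto
  qed
  moreover have "(\<lambda>X. the_elem (f ` X)) ` (A // R) = B"
    using assms(2) val by (auto simp: quotient_def image_iff)
  ultimately show "bij_betw (\<lambda>X. the_elem (f ` X)) (A // R) B"
    by (simp add: bij_betw_def)
qed

text \<open>Group axioms can be pulled back along an injective multiplicative map, because both
  sides of each equation have the same image. This gives the group structure of the sandpile
  quotient.\<close>

lemma group_of_bij_hom:
  assumes "group G" "bij_betw \<phi> (carrier H) (carrier G)"
    and closed: "\<And>a b. a \<in> carrier H \<Longrightarrow> b \<in> carrier H \<Longrightarrow> a \<otimes>\<^bsub>H\<^esub> b \<in> carrier H"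
    and one: "\<one>\<^bsub>H\<^esub> \<in> carrier H" "\<phi> \<one>\<^bsub>H\<^esub> = \<one>\<^bsub>G\<^esub>"
    and hom: "\<And>a b. a \<in> carrier H \<Longrightarrow> b \<in> carrier H \<Longrightarrow> \<phi> (a \<otimes>\<^bsub>H\<^esub> b) = \<phi> a \<otimes>\<^bsub>G\<^esub> \<phi> b"
  shows "group H"
proof -
  interpret G: group G by fact
  have inj: "inj_on \<phi> (carrier H)" and surj: "\<phi> ` carrier H = carrier G"
    using assms(2) by (auto simp: bij_betw_def)
  have [simp]: "\<phi> a \<in> carrier G" if "a \<in> carrier H" for a
    using that surj by auto
  show ?thesis
  proof (rule groupI)
    fix a b c assume "a \<in> carrier H" "b \<in> carrier H" "c \<in> carrier H"
    then show "a \<otimes>\<^bsub>H\<^esub> b \<otimes>\<^bsub>H\<^esub> c = a \<otimes>\<^bsub>H\<^esub> (b \<otimes>\<^bsub>H\<^esub> c)"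
      by (intro inj_onD[OF inj]) (auto simp: hom closed G.m_assoc)
  next
    fix a assume a: "a \<in> carrier H"
    then show "\<one>\<^bsub>H\<^esub> \<otimes>\<^bsub>H\<^esub> a = a"
      by (intro inj_onD[OF inj]) (auto simp: hom closed one)
    obtain b where b: "b \<in> carrier H" "\<phi> b = inv\<^bsub>G\<^esub> \<phi> a"
      using a surj by (metis G.inv_closed imageE imageI)
    with a have "b \<otimes>\<^bsub>H\<^esub> a = \<one>\<^bsub>H\<^esub>"
      by (intro inj_onD[OF inj]) (auto simp: hom closed one)
    with b(1) show "\<exists>b\<in>carrier H. b \<otimes>\<^bsub>H\<^esub> a = \<one>\<^bsub>H\<^esub>" by blast
  qed (auto simp: closed one)
qed

lemma cyclic_integer_mod_group: "cyclic_group (integer_mod_group m)"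
proof -
  have "x \<in> range (\<lambda>k. k mod int m)" if "0 \<le> x" "x < int m" for x
    using that by (intro range_eqI[of _ _ x]) simp
  then have "(\<lambda>k. k mod int m) \<in> epi integer_group (integer_mod_group m)"
    unfolding epi_def hom_def
    by (cases "m = 0") (auto simp: carrier_integer_mod_group mod_add_eq)
  then show ?thesis
    by (rule group.cyclic_group_epimorphic_image[OF group_integer_group
          _ cyclic_integer_group group_integer_mod_group])
qed

lemma int_step_div_mod:
  fixes p N :: int
  assumes "0 < N"
  shows "(p + 1) div N = (if p mod N = N - 1 then p div N + 1 else p div N)"
    and "(p + 1) mod N = (if p mod N = N - 1 then 0 else p mod N + 1)"
proof -
  have p: "p = p mod N + N * (p div N)" by simp
  have r: "0 \<le> p mod N" "p mod N < N" using assms by auto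
  have "(p + 1) div N = (p mod N + 1) div N + p div N"
    using assms by (subst p) (metis add.commute add.left_commute div_mult_self2 order_less_irrefl)
  moreover have "(p + 1) mod N = (p mod N + 1) mod N"
    by (simp add: mod_add_left_eq)
  ultimately show "(p + 1) div N = (if p mod N = N - 1 then p div N + 1 else p div N)"
    "(p + 1) mod N = (if p mod N = N - 1 then 0 else p mod N + 1)"
    using r assms div_pos_pos_trivial[of "p mod N + 1" N] mod_pos_pos_trivial[of "p mod N + 1" N]
    by (cases "p mod N = N - 1"; simp)+
qed

section \<open>Arc counts, edge weights and rotor potentials on the path\<close>

locale path_rotor =
  fixes n x y :: nat
  assumes coprime: "coprime x y" and x_pos: "0 < x" and y_pos: "0 < y"
begin

abbreviation "N \<equiv> int (x + y)"
abbreviation "G \<equiv> path_graph n x y"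
abbreviation "U \<equiv> ups x y"
abbreviation "D \<equiv> downs x y"
abbreviation "w \<equiv> path_weight n x y"
abbreviation "H \<equiv> vertex_h n x y"

lemma N_pos: "0 < N"
  using x_pos by simp

lemma ups_step: "U (p + 1) = U p + (if p mod N < int x then 1 else 0)"
  using int_step_div_mod[OF N_pos, of p] N_pos y_pos x_pos pos_mod_bound[OF N_pos, of p]
  by (auto simp: ups_def min_def algebra_simps)

lemma downs_step: "D (p + 1) = D p + (if p mod N < int x then 0 else 1)"
  by (simp add: downs_def ups_step)

lemma ups_period: "U (p + N * q) = U p + int x * q"
proof -
  have "(p + N * q) div N = q + p div N"
    using N_pos by (intro div_mult_self2) simp
  moreover have "(p + N * q) mod N = p mod N"
    by (rule mod_mult_self2)
  ultimately show ?thesis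
    by (simp only: ups_def distrib_left)
qed

lemma downs_period: "D (p + N * q) = D p + int y * q"
  unfolding downs_def ups_period by (simp add: algebra_simps)

text \<open>A rotor stores only the residue of its lifted position; this allows the count to restart
  from that residue after each routing.\<close>

lemma ups_mod_add: "U (p mod N + m) - U (p mod N) = U (p + m) - U p"
proof -
  have p: "p mod N + N * (p div N) = p"
    by (rule mod_mult_div_eq)
  then have "p mod N + m + N * (p div N) = p + m"
    by linarith
  then have "U (p + m) = U (p mod N + m) + int x * (p div N)"
    using ups_period[of "p mod N + m" "p div N"] by metis
  moreover have "U p = U (p mod N) + int x * (p div N)"
    using ups_period[of "p mod N" "p div N"] p by metis
  ultimately show ?thesis
    by linarith
qed

lemma downs_mod_add: "D (p mod N + m) - D (p mod N) = D (p + m) - D p"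
  using ups_mod_add[of p m] by (simp add: downs_def)

lemma ups_mono: "p \<le> p' \<Longrightarrow> U p \<le> U p'"
  by (induction p' rule: int_ge_induct) (auto simp: ups_step)

lemma downs_mono: "p \<le> p' \<Longrightarrow> D p \<le> D p'"
  by (induction p' rule: int_ge_induct) (auto simp: downs_step)

lemma ups_0: "U 0 = 0" and downs_0: "D 0 = 0"
  by (simp_all add: ups_def downs_def)

lemma vertex_h_0: "H 0 = 0"
  by (simp add: vertex_h_def)

lemma vertex_h_Suc: "H (Suc k) = H k + w k"
  by (simp add: vertex_h_def path_weight_def)

text \<open>Balance at vertex \<open>Suc k\<close>: its \<open>x\<close> right arcs raise h by as
  much as its \<open>y\<close> left arcs lower it. Hence h is harmonic and a full turn costs
  nothing.\<close>

lemma weight_Suc: "k < n \<Longrightarrow> int x * w (Suc k) = int y * w k"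
  by (simp add: path_weight_def Suc_diff_Suc[symmetric] del: Suc_diff_Suc)

lemma vertex_h_last: "H (Suc n) = int (path_order n x y)"
  by (simp add: vertex_h_def path_order_def lessThan_Suc_atMost atMost_atLeast0)

lemma vertex_h_weight_sum: "H (Suc n) = (\<Sum>k\<le>n. w k)"
  by (simp add: vertex_h_def path_weight_def lessThan_Suc_atMost)

lemma vertex_h_n: "H n = int (path_order n x y) - int y ^ n"
  using vertex_h_Suc[of n] by (simp add: vertex_h_last path_weight_def)

lemma order_pos: "0 < path_order n x y"
  using x_pos y_pos by (auto simp: path_order_def intro!: sum_pos)

text \<open>Modulo \<open>y\<close> only the summand \<open>x ^ n\<close> of F survives, and it is
  coprime to \<open>y\<close>.\<close>

lemma coprime_order: "coprime (int (path_order n x y)) (int y ^ n)"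
proof (cases "n = 0")
  case False
  have "path_order n x y = (\<Sum>i\<le>n. x ^ (n - i) * y ^ i)"
    by (simp add: path_order_def atMost_atLeast0)
  also have "\<dots> = x ^ n + (\<Sum>i<n. x ^ (n - Suc i) * y ^ Suc i)"
    by (subst sum.atMost_shift) simp
  also have "(\<Sum>i<n. x ^ (n - Suc i) * y ^ Suc i) = (\<Sum>i<n. x ^ (n - Suc i) * y ^ i) * y"
    by (simp add: sum_distrib_left sum_distrib_right mult_ac)
  finally have "gcd (path_order n x y) y = gcd (x ^ n) y"
    using gcd_add_mult[of y "\<Sum>i<n. x ^ (n - Suc i) * y ^ i" "x ^ n"]
    by (simp only: add.commute gcd.commute)
  also have "\<dots> = 1"
    using coprime by (simp flip: coprime_iff_gcd_eq_1)
  finally have "coprime (path_order n x y) y"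
    by (simp only: coprime_iff_gcd_eq_1)
  then have "coprime (int (path_order n x y)) (int y)"
    by (simp only: coprime_int_iff)
  then show ?thesis
    by simp
qed simp

lemma solve_mod_order: "\<exists>a::int. (a * int y ^ n) mod int (path_order n x y) = m mod int (path_order n x y)"
proof -
  obtain a b where "a * int y ^ n + b * int (path_order n x y) = 1"
    using bezout_int[of "int y ^ n" "int (path_order n x y)"] coprime_order
    by (metis coprime_imp_gcd_eq_1 gcd.commute)
  then have "m * (a * int y ^ n + b * int (path_order n x y)) = m"
    by simp
  then have "m * a * int y ^ n = m + (- (m * b)) * int (path_order n x y)"
    by (simp add: algebra_simps)
  then show ?thesis
    by (metis mod_mult_self1)
qed

text \<open>Extends \<open>arc_g\<close> from arc indices to lifted positions: each right arc passed
  gains \<open>w u\<close>, each left arc loses \<open>w (u - 1)\<close>.\<close>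

definition gval :: "nat \<Rightarrow> int \<Rightarrow> int" where
  "gval u p = U p * w u - D p * w (u - 1)"

lemma gval_period: "u \<in> {1..n} \<Longrightarrow> gval u (p + N * q) = gval u p"
  unfolding gval_def ups_period downs_period
  using weight_Suc[of "u - 1"] by (cases u) (auto simp: algebra_simps)

lemma gval_mod: "u \<in> {1..n} \<Longrightarrow> gval u (p mod N) = gval u p"
  using gval_period[of u "p mod N" "p div N"] by simp

lemma gval_step: "gval u (p + 1) = gval u p + (if p mod N < int x then w u else - w (u - 1))"
  unfolding gval_def ups_step downs_step by (simp add: algebra_simps)

lemma arc_g_eq_gval: "u \<in> {1..n} \<Longrightarrow> j < x + y \<Longrightarrow> arc_g n x y (u, j) = gval u (int j)"
proof (induction j)
  case 0
  then show ?case by (simp add: arc_g_def gval_def ups_0 downs_0)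
next
  case (Suc j)
  then have IH: "arc_g n x y (u, j) = gval u (int j)" by simp
  have m: "int j mod N = int j"
    using Suc.prems by (intro mod_pos_pos_trivial) auto
  have "H u = H (u - 1) + w (u - 1)"
    using Suc.prems vertex_h_Suc[of "u - 1"] by simp
  with IH m gval_step[of u "int j"] vertex_h_Suc[of u] show ?case
    by (auto simp: arc_g_def path_graph_def add.commute)
qed

section \<open>Configurations and the functions g and h in explicit form\<close>

lemma nonsinks_path: "nonsinks G = {1..n}"
  by (auto simp: nonsinks_def path_graph_def)

lemma verts_path: "verts G = {..Suc n}"
  by (auto simp: path_graph_def)

lemma particle_configs_iff: "\<sigma> \<in> particle_configs G \<longleftrightarrow> \<sigma> \<in> extensional {..Suc n}"
  by (simp add: particle_group_def verts_path PiE_iff)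

lemma rotor_configs_iff: "\<rho> \<in> rotor_configs G \<longleftrightarrow>
    \<rho> \<in> extensional {1..n} \<and> (\<forall>u\<in>{1..n}. fst (\<rho> u) = u \<and> snd (\<rho> u) < x + y)"
  unfolding rotor_configs_def nonsinks_path PiE_iff
  by (auto simp: out_arcs_def pre_digraph.truncate_def path_graph_def mem_Times_iff)

lemma path_h_eq: "path_h n x y \<sigma> = (\<Sum>v\<le>Suc n. \<sigma> v * H v)"
  by (simp add: path_h_def verts_path)

lemma path_g_eq:
  assumes "\<rho> \<in> rotor_configs G"
  shows "path_g n x y \<rho> = (\<Sum>u=1..n. gval u (int (snd (\<rho> u))))"
  unfolding path_g_def nonsinks_path
proof (rule sum.cong)
  fix u assume u: "u \<in> {1..n}"
  with assms have "\<rho> u = (u, snd (\<rho> u))" "snd (\<rho> u) < x + y"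
    by (auto simp: rotor_configs_iff prod_eq_iff)
  then show "arc_g n x y (\<rho> u) = gval u (int (snd (\<rho> u)))"
    using arc_g_eq_gval[OF u] by metis
qed simp


section \<open>Closed form of routing\<close>

text \<open>Change of the particle number on \<open>v\<close> under \<open>m\<close> routings at a
  nonsink \<open>u\<close> from rotor position \<open>p\<close>. The signed counts also cover
  inverse routings, where \<open>m\<close> is negative.\<close>

definition flow :: "nat \<Rightarrow> int \<Rightarrow> int \<Rightarrow> nat \<Rightarrow> int" where
  "flow u p m v = (if v = Suc u then U (p + m) - U p else 0)
     + (if v = u - 1 then D (p + m) - D p else 0) - (if v = u then m else 0)"

text \<open>Integer powers of the routing at \<open>u\<close> in closed form. Outside
  \<open>rp_configs G\<close> this need not be the identity, so it is compared with
  \<open>routing_plus\<close> only on configurations.\<close>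

definition act :: "nat \<Rightarrow> int \<Rightarrow> (nat, nat \<times> nat) rotor_particle \<Rightarrow> (nat, nat \<times> nat) rotor_particle" where
  "act u m = (\<lambda>(\<rho>, \<sigma>). (\<rho>(u := (u, nat ((int (snd (\<rho> u)) + m) mod N))),
     \<lambda>v\<in>{..Suc n}. \<sigma> v + flow u (int (snd (\<rho> u))) m v))"

text \<open>Cocycle identity behind \<open>act_add\<close>: the second batch starts at the rotor
  position reached by the first.\<close>

lemma flow_add: "flow u p (k + m) v = flow u p k v + flow u ((p + k) mod N) m v"
  unfolding flow_def ups_mod_add downs_mod_add by (simp add: add.assoc)

lemma nat_mod_N: "nat (p mod N) < x + y" "int (nat (p mod N)) = p mod N"
proof -
  have "0 \<le> p mod N" "p mod N < N"
    using N_pos by (simp_all del: of_nat_add)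
  then show "nat (p mod N) < x + y" "int (nat (p mod N)) = p mod N"
    by linarith+
qed

lemma rotor_update:
  assumes "\<rho> \<in> rotor_configs G" "u \<in> {1..n}"
  shows "\<rho>(u := (u, nat (p mod N))) \<in> rotor_configs G"
  using assms nat_mod_N(1)[of p] by (auto simp: rotor_configs_iff extensional_def)

lemma act_closed:
  assumes "c \<in> rp_configs G" "u \<in> {1..n}"
  shows "act u m c \<in> rp_configs G"
  using assms by (auto simp: rp_configs_def act_def rotor_update particle_configs_iff
      simp del: carrier_product_group of_nat_add split: prod.splits)

lemma act_add:
  assumes "u \<in> {1..n}"
  shows "act u m (act u k c) = act u (k + m) c"
proof -
  obtain \<rho> \<sigma> where c: "c = (\<rho>, \<sigma>)" by (cases c)
  have "((int (snd (\<rho> u)) + k) mod N + m) mod N = (int (snd (\<rho> u)) + (k + m)) mod N"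
    by (simp only: mod_add_left_eq add.assoc)
  then show ?thesis
    by (simp add: c act_def flow_add nat_mod_N(2) restrict_def fun_eq_iff del: of_nat_add int_nat_eq)
qed

lemma act_0:
  assumes "c \<in> rp_configs G" "u \<in> {1..n}"
  shows "act u 0 c = c"
proof -
  obtain \<rho> \<sigma> where c: "c = (\<rho>, \<sigma>)" by (cases c)
  have \<rho>: "fst (\<rho> u) = u" "snd (\<rho> u) < x + y" and \<sigma>: "\<sigma> \<in> extensional {..Suc n}"
    using assms by (auto simp: c rp_configs_def rotor_configs_iff particle_configs_iff
        simp del: carrier_product_group)
  have "int (snd (\<rho> u)) mod N = int (snd (\<rho> u))"
    using \<rho>(2) by (intro mod_pos_pos_trivial) auto
  moreover have "\<rho>(u := (u, snd (\<rho> u))) = \<rho>"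
    using \<rho>(1) by (metis fun_upd_triv prod.collapse)
  moreover have "(\<lambda>v\<in>{..Suc n}. \<sigma> v + flow u p 0 v) = \<sigma>" for p
    using \<sigma> by (auto simp: flow_def restrict_def extensional_def fun_eq_iff)
  ultimately show ?thesis
    by (simp add: c act_def del: of_nat_add)
qed

lemma routing_plus_eq_act:
  assumes "c \<in> rp_configs G" "u \<in> {1..n}"
  shows "routing_plus G u c = act u 1 c"
proof -
  obtain \<rho> \<sigma> where c: "c = (\<rho>, \<sigma>)" by (cases c)
  have \<rho>: "fst (\<rho> u) = u" "snd (\<rho> u) < x + y"
    using assms by (auto simp: c rp_configs_def rotor_configs_iff)
  obtain j where j: "\<rho> u = (u, j)" "j < x + y"
    using \<rho> by (metis prod.collapse)
  have "(int j + 1) mod N = int ((j + 1) mod (x + y))"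
    by (simp only: of_nat_mod of_nat_add of_nat_1)
  then have next_rotor: "next_rotor G (\<rho> u) = (u, nat ((int j + 1) mod N))"
    using j by (simp add: path_graph_def del: of_nat_add)
  have m: "int j mod N = int j"
    using j(2) by (intro mod_pos_pos_trivial) auto
  have flow: "flow u (int j) 1 v = (if v = head G (\<rho> u) then 1 else 0) - (if v = u then 1 else 0)" for v
    unfolding flow_def ups_step downs_step m using j assms(2) by (auto simp: path_graph_def)
  have "(\<lambda>v\<in>verts G. \<sigma> v + one_particle G (head G (\<rho> u)) v - one_particle G u v)
      = (\<lambda>v\<in>{..Suc n}. \<sigma> v + flow u (int j) 1 v)"
    by (auto simp: one_particle_def flow verts_path fun_eq_iff)
  then show ?thesis
    using assms(1) by (simp add: c routing_plus_def act_def next_rotor[unfolded j(1)] j(1) del: of_nat_add)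
qed

lemma routing_plus_outside: "c \<notin> rp_configs G \<Longrightarrow> routing_plus G u c = c"
  by (simp add: routing_plus_def)

text \<open>Negative powers use \<open>inv_into UNIV\<close>, so injectivity is required on the
  whole type: \<open>act u (-1)\<close> is a left inverse on configurations, the map is the identity
  elsewhere, and \<open>closed\<close> keeps the two regions apart.\<close>

lemma inj_routing_plus:
  assumes "u \<in> {1..n}"
  shows "inj (routing_plus G u)"
proof (rule injI)
  fix c c' assume eq: "routing_plus G u c = routing_plus G u c'"
  have left_inverse: "act u (-1) (routing_plus G u c) = c" if "c \<in> rp_configs G" for c
    using that assms by (simp add: routing_plus_eq_act act_add act_0)
  have closed: "routing_plus G u c \<in> rp_configs G \<longleftrightarrow> c \<in> rp_configs G" for c
    using assms act_closed by (cases "c \<in> rp_configs G") (simp_all add: routing_plus_eq_act routing_plus_outside)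
  show "c = c'"
    using eq left_inverse[of c] left_inverse[of c'] closed[of c] closed[of c']
      routing_plus_outside[of c] routing_plus_outside[of c'] by (cases "c \<in> rp_configs G") auto
qed

lemma inv_routing_plus:
  assumes "u \<in> {1..n}"
  shows "c \<in> rp_configs G \<Longrightarrow> inv_into UNIV (routing_plus G u) c = act u (-1) c"
    and "c \<notin> rp_configs G \<Longrightarrow> inv_into UNIV (routing_plus G u) c = c"
  using assms by (auto intro!: inv_f_eq inj_routing_plus
      simp: routing_plus_eq_act act_closed act_add act_0 routing_plus_outside)

lemma int_funpow_routing_plus:
  assumes "u \<in> {1..n}"
  shows "c \<in> rp_configs G \<Longrightarrow> int_funpow (routing_plus G u) k c = act u k c"
    and "c \<notin> rp_configs G \<Longrightarrow> int_funpow (routing_plus G u) k c = c"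
proof -
  have pos: "(routing_plus G u ^^ i) c = act u (int i) c"
    and neg: "(inv_into UNIV (routing_plus G u) ^^ i) c = act u (- int i) c"
    if c: "c \<in> rp_configs G" for i
  proof (induction i)
    case (Suc i)
    {
      case 1
      have "(routing_plus G u ^^ Suc i) c = act u 1 (act u (int i) c)"
        using c assms Suc by (simp add: routing_plus_eq_act act_closed)
      also have "\<dots> = act u (int (Suc i)) c"
        using assms by (simp add: act_add add.commute)
      finally show ?case .
    next
      case 2
      have "(inv_into UNIV (routing_plus G u) ^^ Suc i) c = act u (-1) (act u (- int i) c)"
        using c assms Suc by (simp add: inv_routing_plus(1) act_closed)
      also have "\<dots> = act u (- int (Suc i)) c"
        using assms by (simp add: act_add algebra_simps)
      finally show ?case .
    }
  qed (use c assms in \<open>simp_all add: act_0\<close>)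
  show "c \<in> rp_configs G \<Longrightarrow> int_funpow (routing_plus G u) k c = act u k c"
    using pos[of "nat k"] neg[of "nat (- k)"] by (auto simp: int_funpow_def)
  have "(routing_plus G u ^^ i) c = c" "(inv_into UNIV (routing_plus G u) ^^ i) c = c" if "c \<notin> rp_configs G" for i
    using that assms by (induction i) (simp_all add: routing_plus_outside inv_routing_plus)
  then show "c \<notin> rp_configs G \<Longrightarrow> int_funpow (routing_plus G u) k c = c"
    by (simp add: int_funpow_def)
qed

text \<open>The flow at a vertex depends only on the rotor of that vertex, and changes of particle
  numbers add up.\<close>

lemma act_commute: "u \<noteq> u' \<Longrightarrow> act u k (act u' m c) = act u' m (act u k c)"
proof -
  assume u: "u \<noteq> u'"
  obtain \<rho> \<sigma> where c: "c = (\<rho>, \<sigma>)" by (cases c)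
  have "\<rho>(u' := a, u := b) = \<rho>(u := b, u' := a)" for a b
    using u by (rule fun_upd_twist[OF not_sym])
  then show ?thesis
    using u by (simp add: c act_def restrict_def fun_eq_iff del: of_nat_add)
qed

lemma comp_fun_commute_on_routing:
  "comp_fun_commute_on {1..n} (\<lambda>u. int_funpow (routing_plus G u) (r u))"
proof
  fix u u' assume u: "u \<in> {1..n}" "u' \<in> {1..n}"
  show "int_funpow (routing_plus G u') (r u') \<circ> int_funpow (routing_plus G u) (r u) =
    int_funpow (routing_plus G u) (r u) \<circ> int_funpow (routing_plus G u') (r u')"
  proof
    fix c
    show "(int_funpow (routing_plus G u') (r u') \<circ> int_funpow (routing_plus G u) (r u)) c =
      (int_funpow (routing_plus G u) (r u) \<circ> int_funpow (routing_plus G u') (r u')) c"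
      using u act_commute[of u u'] by (cases "c \<in> rp_configs G"; cases "u = u'")
        (simp_all add: int_funpow_routing_plus act_closed)
  qed
qed

text \<open>Routing at one vertex leaves the other rotors alone, so every \<open>flow\<close> may be
  evaluated at the initial \<open>\<rho>\<close>.\<close>

lemma routing_eq:
  assumes "(\<rho>, \<sigma>) \<in> rp_configs G"
  shows "routing G r (\<rho>, \<sigma>) =
    (\<lambda>u. if u \<in> {1..n} then (u, nat ((int (snd (\<rho> u)) + r u) mod N)) else \<rho> u,
     \<lambda>v\<in>{..Suc n}. \<sigma> v + (\<Sum>u=1..n. flow u (int (snd (\<rho> u))) (r u) v))"
proof -
  interpret comp_fun_commute_on "{1..n}" "\<lambda>u. int_funpow (routing_plus G u) (r u)"
    by (rule comp_fun_commute_on_routing)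
  \<comment> \<open>Membership in \<open>rp_configs G\<close> is carried through the induction
    because \<open>int_funpow\<close> agrees with \<open>act\<close> only there.\<close>
  have "Finite_Set.fold (\<lambda>u. int_funpow (routing_plus G u) (r u)) (\<rho>, \<sigma>) A \<in> rp_configs G \<and>
    Finite_Set.fold (\<lambda>u. int_funpow (routing_plus G u) (r u)) (\<rho>, \<sigma>) A =
    (\<lambda>u. if u \<in> A then (u, nat ((int (snd (\<rho> u)) + r u) mod N)) else \<rho> u,
     \<lambda>v\<in>{..Suc n}. \<sigma> v + (\<Sum>u\<in>A. flow u (int (snd (\<rho> u))) (r u) v))"
    if "finite A" "A \<subseteq> {1..n}" for A
    using that
  proof (induction A rule: finite_induct)
    case empty
    have "\<sigma> \<in> extensional {..Suc n}"
      using assms by (auto simp: rp_configs_def particle_configs_iff simp del: carrier_product_group)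
    then have "restrict \<sigma> {..Suc n} = \<sigma>"
      by (rule extensional_restrict)
    then show ?case
      using assms by simp
  next
    case (insert a A)
    let ?f = "Finite_Set.fold (\<lambda>u. int_funpow (routing_plus G u) (r u)) (\<rho>, \<sigma>)"
    have IH: "?f A \<in> rp_configs G" "?f A =
        (\<lambda>u. if u \<in> A then (u, nat ((int (snd (\<rho> u)) + r u) mod N)) else \<rho> u,
         \<lambda>v\<in>{..Suc n}. \<sigma> v + (\<Sum>u\<in>A. flow u (int (snd (\<rho> u))) (r u) v))"
      using insert by auto
    have step: "?f (insert a A) = act a (r a) (?f A)"
      using insert IH(1) int_funpow_routing_plus(1)[of a "?f A" "r a"] by (subst fold_insert) auto
    have closed: "act a (r a) (?f A) \<in> rp_configs G"
      using IH(1) insert.prems by (intro act_closed) auto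
    have "act a (r a) (?f A) =
        (\<lambda>u. if u \<in> insert a A then (u, nat ((int (snd (\<rho> u)) + r u) mod N)) else \<rho> u,
         \<lambda>v\<in>{..Suc n}. \<sigma> v + (\<Sum>u\<in>insert a A. flow u (int (snd (\<rho> u))) (r u) v))"
      unfolding IH(2) using insert.hyps by (auto simp: act_def fun_eq_iff simp del: of_nat_add)
    with closed show ?case
      unfolding step by (rule conjI)
  qed
  from this[of "{1..n}"] show ?thesis
    by (simp add: routing_def nonsinks_path del: of_nat_add)
qed

section \<open>Conservation laws and net edge currents\<close>

lemma sum_sinks: "(\<Sum>v\<le>Suc n. f v) = f 0 + (\<Sum>v=1..n. f v) + f (Suc n)" for f :: "nat \<Rightarrow> int"
proof -
  have "{..n} = insert 0 {1..n}" by auto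
  then show ?thesis by simp
qed

lemma flow_degree:
  assumes "u \<in> {1..n}"
  shows "(\<Sum>v\<le>Suc n. flow u p m v) = 0"
  using assms unfolding flow_def sum.distrib sum_subtractf
  by (auto simp: downs_def simp del: sum.atMost_Suc)

text \<open>Splitting the \<open>m\<close> departures by direction, a right arrival gains
  \<open>w u\<close> over \<open>H u\<close> and a left one loses \<open>w (u - 1)\<close>. This is
  the local form of the conservation of g - h.\<close>

lemma flow_h:
  assumes "u \<in> {1..n}"
  shows "(\<Sum>v\<le>Suc n. flow u p m v * H v) = gval u (p + m) - gval u p"
proof -
  have "(\<Sum>v\<le>Suc n. flow u p m v * H v) = (\<Sum>v\<le>Suc n.
      (if v = Suc u then (U (p + m) - U p) * H (Suc u) else 0)
      + (if v = u - 1 then (D (p + m) - D p) * H (u - 1) else 0) - (if v = u then m * H u else 0))"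
    by (rule sum.cong) (auto simp: flow_def algebra_simps)
  also have "\<dots> = (U (p + m) - U p) * H (Suc u) + (D (p + m) - D p) * H (u - 1) - m * H u"
  proof -
    have "u - 1 \<le> Suc n" using assms by auto
    then show ?thesis
      using assms unfolding sum.distrib sum_subtractf by (simp del: sum.atMost_Suc)
  qed
  also have "\<dots> = gval u (p + m) - gval u p"
    using vertex_h_Suc[of u] vertex_h_Suc[of "u - 1"] assms
    by (simp add: gval_def downs_def algebra_simps)
  finally show ?thesis .
qed

text \<open>The net number of particles crossing from \<open>k\<close> to \<open>k + 1\<close> when the rotor position \<open>J u\<close>
  is advanced by \<open>r u\<close> steps at every nonsink \<open>u\<close>.\<close>

definition net :: "(nat \<Rightarrow> int) \<Rightarrow> (nat \<Rightarrow> int) \<Rightarrow> nat \<Rightarrow> int" where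
  "net J r k = (if 1 \<le> k then U (J k + r k) - U (J k) else 0)
     - (if k < n then D (J (Suc k) + r (Suc k)) - D (J (Suc k)) else 0)"

text \<open>Continuity equation: current entering over the left edge minus current leaving over the
  right edge, with no edge beyond either sink.\<close>

lemma flow_sum_net:
  assumes "v \<le> Suc n"
  shows "(\<Sum>u=1..n. flow u (J u) (r u) v)
    = (if v = 0 then 0 else net J r (v - 1)) - (if v = Suc n then 0 else net J r v)"
proof -
  define A where "A u = U (J u + r u) - U (J u)" for u
  define B where "B u = D (J u + r u) - D (J u)" for u
  have r: "r u = A u + B u" for u
    by (simp add: A_def B_def downs_def)
  \<comment> \<open>The guard \<open>2 \<le> v\<close> reflects that a right arrival at
    \<open>v\<close> comes from a nonsink: the vertex 0 emits nothing, and \<open>v - 1\<close>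
    truncates at 0.\<close>
  have "(\<Sum>u=1..n. flow u (J u) (r u) v) = (\<Sum>u=1..n.
      (if u = v - 1 then (if 2 \<le> v then A u else 0) else 0) + (if u = Suc v then B u else 0)
      - (if u = v then A u + B u else 0))"
    by (rule sum.cong) (auto simp: flow_def A_def B_def downs_def)
  also have "\<dots> = (if 2 \<le> v then A (v - 1) else 0) + (if v < n then B (Suc v) else 0)
      - (if v \<in> {1..n} then A v + B v else 0)"
    using assms unfolding sum.distrib sum_subtractf by auto
  also have "\<dots> = (if v = 0 then 0 else net J r (v - 1)) - (if v = Suc n then 0 else net J r v)"
    unfolding net_def using assms by (cases v) (auto simp flip: A_def B_def)
  finally show ?thesis .
qed

text \<open>Regrouping by vertices: right arcs of \<open>u\<close> cross edge \<open>u\<close>, left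
  arcs cross edge \<open>u - 1\<close>.\<close>

lemma net_sum_weight:
  "(\<Sum>k\<le>n. net J r k * w k) = (\<Sum>u=1..n. gval u (J u + r u) - gval u (J u))"
proof -
  define A where "A u = U (J u + r u) - U (J u)" for u
  define B where "B u = D (J u + r u) - D (J u)" for u
  have "(\<Sum>k\<le>n. net J r k * w k)
      = (\<Sum>k\<le>n. (if 1 \<le> k then A k * w k else 0)) - (\<Sum>k\<le>n. (if k < n then B (Suc k) * w k else 0))"
    unfolding net_def A_def B_def sum_subtractf[symmetric] by (rule sum.cong) (auto simp: algebra_simps)
  also have "(\<Sum>k\<le>n. (if 1 \<le> k then A k * w k else 0)) = (\<Sum>u=1..n. A u * w u)"
    by (rule sum.mono_neutral_cong_right) auto
  also have "(\<Sum>k\<le>n. (if k < n then B (Suc k) * w k else 0)) = (\<Sum>k<n. B (Suc k) * w k)"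
    by (rule sum.mono_neutral_cong_right) auto
  also have "\<dots> = (\<Sum>u=1..n. B u * w (u - 1))"
    by (simp add: sum.atLeast1_atMost_eq)
  finally show ?thesis
    by (simp add: gval_def A_def B_def sum_subtractf[symmetric] algebra_simps)
qed

text \<open>Full turns of the rotors change the net flows by exactly the flows \<open>f\<close>
  with \<open>\<Sum>k\<le>n. f k * w k = 0\<close>, so this sum is the only obstruction.\<close>

lemma exists_rotation:
  assumes "\<rho> \<in> rotor_configs G" "\<rho>' \<in> rotor_configs G"
    and "(\<Sum>k\<le>n. e k * w k) = path_g n x y \<rho>' - path_g n x y \<rho>"
  shows "\<exists>r. (\<forall>u\<in>{1..n}. (int (snd (\<rho> u)) + r u) mod N = int (snd (\<rho>' u))) \<and>
    (\<forall>k\<le>n. net (\<lambda>u. int (snd (\<rho> u))) r k = e k)"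
proof -
  define J where "J u = int (snd (\<rho> u))" for u
  define J' where "J' u = int (snd (\<rho>' u))" for u
  define d where "d u = J' u - J u" for u
  \<comment> \<open>The direct rotation \<open>d\<close> already has the prescribed total weight, so
    the missing current has weight zero and decomposes into full turns.\<close>
  have "(\<Sum>k\<le>n. net J d k * w k) = path_g n x y \<rho>' - path_g n x y \<rho>"
    unfolding net_sum_weight using assms(1,2)
    by (simp add: d_def path_g_eq J_def J'_def sum_subtractf)
  then have "(\<Sum>k\<le>n. (e k - net J d k) * w k) = 0"
    using assms(3) by (simp add: left_diff_distrib sum_subtractf)
  from coprime_flow_decomposition[OF coprime x_pos this] obtain q where q:
    "q 0 = 0" "q (Suc n) = 0" "\<And>k. k \<le> n \<Longrightarrow> e k - net J d k = int x * q k - int y * q (Suc k)"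
    by auto
  \<comment> \<open>Adding \<open>q u\<close> full turns keeps the final rotor and supplies the
    missing current; \<open>q\<close> vanishes at both sinks, which have no rotor.\<close>
  define r where "r u = d u + N * q u" for u
  have "(J u + r u) mod N = J' u" if "u \<in> {1..n}" for u
  proof -
    have "snd (\<rho>' u) < x + y"
      using assms(2) that by (simp add: rotor_configs_iff)
    then have "J' u mod N = J' u"
      unfolding J'_def by (intro mod_pos_pos_trivial) auto
    moreover have "J u + r u = J' u + N * q u"
      by (simp add: r_def d_def)
    ultimately show ?thesis
      by (simp only: mod_mult_self2)
  qed
  moreover have "net J r k = e k" if "k \<le> n" for k
  proof -
    have "U (J k + r k) = U (J k + d k) + int x * q k" "D (J k + r k) = D (J k + d k) + int y * q k" for k
      using ups_period[of "J k + d k" "q k"] downs_period[of "J k + d k" "q k"]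
      by (simp_all only: r_def add.assoc)
    then have "net J r k = net J d k + (int x * q k - int y * q (Suc k))"
      unfolding net_def using q(1,2) that by (cases "k = 0"; cases "k = n") auto
    then show ?thesis
      using q(3)[OF that] by simp
  qed
  ultimately show ?thesis
    unfolding J_def J'_def by blast
qed

section \<open>Completeness of the two invariants\<close>

text \<open>Abel summation with \<open>w\<close> as the increments of \<open>H\<close>.\<close>

lemma prefix_sum_weight:
  "(\<Sum>k\<le>m. (\<Sum>v\<le>k. \<tau> v) * w k) = (\<Sum>v\<le>Suc m. \<tau> v) * H (Suc m) - (\<Sum>v\<le>Suc m. \<tau> v * H v)"
  by (induction m) (simp_all add: vertex_h_Suc vertex_h_0 algebra_simps)

text \<open>Necessity sums \<open>flow_degree\<close> and \<open>flow_h\<close> over the nonsinks.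
  For sufficiency, the particle numbers dictate the current across every edge, and equality of g - h
  is what \<open>exists_rotation\<close> needs to realise it.\<close>

lemma rp_equiv_iff:
  "((\<rho>, \<sigma>), (\<rho>', \<sigma>')) \<in> rp_equiv G \<longleftrightarrow> (\<rho>, \<sigma>) \<in> rp_configs G \<and> (\<rho>', \<sigma>') \<in> rp_configs G \<and>
    (\<Sum>v\<le>Suc n. \<sigma> v) = (\<Sum>v\<le>Suc n. \<sigma>' v) \<and>
    path_g n x y \<rho> - path_h n x y \<sigma> = path_g n x y \<rho>' - path_h n x y \<sigma>'"
  (is "?L \<longleftrightarrow> ?c \<and> ?c' \<and> ?deg \<and> ?inv")
proof
  assume ?L
  then obtain r where c: ?c and c': ?c' and r: "routing G r (\<rho>, \<sigma>) = (\<rho>', \<sigma>')"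
    by (auto simp: rp_equiv_def)
  let ?J = "\<lambda>u. int (snd (\<rho> u))"
  have \<rho>': "int (snd (\<rho>' u)) = (?J u + r u) mod N" if "u \<in> {1..n}" for u
    using r that nat_mod_N(2) unfolding routing_eq[OF c] by (auto simp del: of_nat_add int_nat_eq)
  have \<sigma>': "\<sigma>' v = \<sigma> v + (\<Sum>u=1..n. flow u (?J u) (r u) v)" if "v \<le> Suc n" for v
    using r that unfolding routing_eq[OF c] by (auto simp del: of_nat_add)
  have "(\<Sum>v\<le>Suc n. \<sigma>' v) = (\<Sum>v\<le>Suc n. \<sigma> v) + (\<Sum>v\<le>Suc n. \<Sum>u=1..n. flow u (?J u) (r u) v)"
    unfolding sum.distrib[symmetric] by (rule sum.cong) (simp_all only: \<sigma>' atMost_iff)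
  also have "(\<Sum>v\<le>Suc n. \<Sum>u=1..n. flow u (?J u) (r u) v) = 0"
    by (subst sum.swap) (simp add: flow_degree del: sum.atMost_Suc)
  finally have deg: ?deg by simp
  have "path_h n x y \<sigma>' = (\<Sum>v\<le>Suc n. \<sigma> v * H v + (\<Sum>u=1..n. flow u (?J u) (r u) v * H v))"
    unfolding path_h_eq by (rule sum.cong) (simp_all add: \<sigma>' distrib_right sum_distrib_right)
  also have "\<dots> = path_h n x y \<sigma> + (\<Sum>u=1..n. \<Sum>v\<le>Suc n. flow u (?J u) (r u) v * H v)"
    unfolding path_h_eq sum.distrib by (subst sum.swap) (rule refl)
  also have "(\<Sum>u=1..n. \<Sum>v\<le>Suc n. flow u (?J u) (r u) v * H v)
      = (\<Sum>u=1..n. gval u (int (snd (\<rho>' u))) - gval u (?J u))"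
    by (rule sum.cong) (simp_all only: flow_h \<rho>' gval_mod)
  also have "\<dots> = path_g n x y \<rho>' - path_g n x y \<rho>"
    using c c' by (simp add: rp_configs_def path_g_eq sum_subtractf)
  finally show "?c \<and> ?c' \<and> ?deg \<and> ?inv"
    using c c' deg by simp
next
  assume "?c \<and> ?c' \<and> ?deg \<and> ?inv"
  then have c: ?c and c': ?c' and deg: ?deg and inv: ?inv by auto
  have \<rho>: "\<rho> \<in> rotor_configs G" "\<rho>' \<in> rotor_configs G"
    and \<sigma>': "\<sigma>' \<in> extensional {..Suc n}"
    using c c' by (auto simp: rp_configs_def particle_configs_iff simp del: carrier_product_group)
  \<comment> \<open>The net current across edge \<open>k\<close> has to be the surplus of
    \<open>\<sigma>\<close> over \<open>\<sigma>'\<close> on the vertices up to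
    \<open>k\<close>.\<close>
  define e where "e k = (\<Sum>v\<le>k. \<sigma> v - \<sigma>' v)" for k
  have "(\<Sum>k\<le>n. e k * w k) = path_h n x y \<sigma>' - path_h n x y \<sigma>"
    unfolding e_def prefix_sum_weight path_h_eq
    using deg by (simp add: sum_subtractf left_diff_distrib)
  then have "(\<Sum>k\<le>n. e k * w k) = path_g n x y \<rho>' - path_g n x y \<rho>"
    using inv by simp
  from exists_rotation[OF \<rho> this] obtain r where
    r: "\<And>u. u \<in> {1..n} \<Longrightarrow> (int (snd (\<rho> u)) + r u) mod N = int (snd (\<rho>' u))"
      "\<And>k. k \<le> n \<Longrightarrow> net (\<lambda>u. int (snd (\<rho> u))) r k = e k"
    by blast
  have "(if u \<in> {1..n} then (u, nat ((int (snd (\<rho> u)) + r u) mod N)) else \<rho> u) = \<rho>' u" for u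
    using \<rho> r(1)[of u] by (auto simp: rotor_configs_iff extensional_def prod_eq_iff simp del: of_nat_add)
  moreover have "\<sigma> v + (\<Sum>u=1..n. flow u (int (snd (\<rho> u))) (r u) v) = \<sigma>' v" if "v \<le> Suc n" for v
  proof -
    \<comment> \<open>Equality of the total particle numbers settles the balance at the right
      sink.\<close>
    have last: "e (Suc n) = 0"
      unfolding e_def sum_subtractf using deg by simp
    show ?thesis
      unfolding flow_sum_net[OF that, of "\<lambda>u. int (snd (\<rho> u))"]
      using r(2)[of v] r(2)[of "v - 1"] last that by (cases v) (auto simp: e_def)
  qed
  then have "(\<lambda>v\<in>{..Suc n}. \<sigma> v + (\<Sum>u=1..n. flow u (int (snd (\<rho> u))) (r u) v)) = \<sigma>'"
    using \<sigma>' by (auto simp: restrict_def extensional_def fun_eq_iff)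
  ultimately have "routing G r (\<rho>, \<sigma>) = (\<rho>', \<sigma>')"
    unfolding routing_eq[OF c] by presburger
  then show ?L
    using c c' by (auto simp: rp_equiv_def)
qed

section \<open>Values of g modulo F\<close>

text \<open>A positive current across every edge would require the rotor of \<open>u\<^sub>1\<close> to turn backwards,
  hence, inductively, also that of \<open>u\<^sub>n\<close>, which then cannot emit particles to the right.\<close>

lemma path_g_no_shift:
  assumes "\<rho> \<in> rotor_configs G" "\<rho>' \<in> rotor_configs G" "0 < t"
  shows "path_g n x y \<rho>' \<noteq> path_g n x y \<rho> + t * int (path_order n x y)"
proof
  assume "path_g n x y \<rho>' = path_g n x y \<rho> + t * int (path_order n x y)"
  \<comment> \<open>F is the sum of all edge weights, so a shift of g by \<open>t\<close> times F
    corresponds to the constant current \<open>t\<close>.\<close>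
  then have "(\<Sum>k\<le>n. t * w k) = path_g n x y \<rho>' - path_g n x y \<rho>"
    by (simp add: vertex_h_weight_sum flip: vertex_h_last sum_distrib_left)
  from exists_rotation[OF assms(1,2) this] obtain r where
    r: "\<And>k. k \<le> n \<Longrightarrow> net (\<lambda>u. int (snd (\<rho> u))) r k = t"
    by auto
  have D: "k < n \<Longrightarrow> D (int (snd (\<rho> (Suc k))) + r (Suc k)) < D (int (snd (\<rho> (Suc k))))" for k
  proof (induction k)
    case 0
    then show ?case using r[of 0] assms(3) by (simp add: net_def)
  next
    case (Suc k)
    then have "int (snd (\<rho> (Suc k))) + r (Suc k) \<le> int (snd (\<rho> (Suc k)))"
      using downs_mono by (metis Suc_lessD linorder_le_cases not_le)
    then show ?case
      using ups_mono[of "int (snd (\<rho> (Suc k))) + r (Suc k)" "int (snd (\<rho> (Suc k)))"]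
        r[of "Suc k"] Suc.prems assms(3) by (simp add: net_def)
  qed
  show False
  proof (cases n)
    case 0
    then show ?thesis using r[of 0] assms(3) unfolding net_def by simp
  next
    case (Suc k)
    with D[of k] have "int (snd (\<rho> n)) + r n \<le> int (snd (\<rho> n))"
      using downs_mono by (metis lessI linorder_le_cases not_le)
    then show ?thesis
      using ups_mono[of "int (snd (\<rho> n)) + r n" "int (snd (\<rho> n))"] r[of n] assms(3)
      unfolding net_def using Suc by simp
  qed
qed

text \<open>\<open>path_g_no_shift\<close> excludes a positive multiple of F as the difference and,
  with the configurations exchanged, a negative one.\<close>

lemma path_g_mod_eq_iff:
  assumes "\<rho> \<in> rotor_configs G" "\<rho>' \<in> rotor_configs G"
  shows "path_g_mod n x y \<rho> = path_g_mod n x y \<rho>' \<longleftrightarrow> path_g n x y \<rho> = path_g n x y \<rho>'"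
proof
  assume "path_g_mod n x y \<rho> = path_g_mod n x y \<rho>'"
  then have "int (path_order n x y) dvd path_g n x y \<rho> - path_g n x y \<rho>'"
    by (simp add: path_g_mod_def mod_eq_dvd_iff)
  then obtain t where t: "path_g n x y \<rho> = path_g n x y \<rho>' + t * int (path_order n x y)"
    by (metis add_diff_cancel_left' diff_add_cancel add.commute dvdE mult.commute)
  then have t': "path_g n x y \<rho>' = path_g n x y \<rho> + (- t) * int (path_order n x y)"
    by simp
  have "\<not> 0 < t" "\<not> 0 < - t"
    using t t' path_g_no_shift assms by blast+
  then show "path_g n x y \<rho> = path_g n x y \<rho>'"
    using t by (metis add_0_right linorder_neqE_linordered_idom mult_zero_left neg_0_less_iff_less)
qed (simp add: path_g_mod_def)

lemma path_g_update:
  assumes "\<rho> \<in> rotor_configs G" "u \<in> {1..n}"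
  shows "path_g n x y (\<rho>(u := (u, nat (p mod N)))) = path_g n x y \<rho> - gval u (int (snd (\<rho> u))) + gval u p"
proof -
  let ?\<rho> = "\<rho>(u := (u, nat (p mod N)))"
  have "(\<Sum>v=1..n. gval v (int (snd (?\<rho> v)))) =
      gval u (int (snd (?\<rho> u))) + (\<Sum>v\<in>{1..n} - {u}. gval v (int (snd (?\<rho> v))))"
    using assms(2) by (intro sum.remove) auto
  also have "(\<Sum>v\<in>{1..n} - {u}. gval v (int (snd (?\<rho> v)))) = (\<Sum>v\<in>{1..n} - {u}. gval v (int (snd (\<rho> v))))"
    by (rule sum.cong) auto
  also have "\<dots> = (\<Sum>v=1..n. gval v (int (snd (\<rho> v)))) - gval u (int (snd (\<rho> u)))"
    using assms(2) by (subst sum.remove[of _ u]) auto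
  also have "gval u (int (snd (?\<rho> u))) = gval u p"
    using assms(2) nat_mod_N(2)[of p] gval_mod[of u p] by (simp del: of_nat_add int_nat_eq)
  finally show ?thesis
    using rotor_update[OF assms] assms(1) by (simp add: path_g_eq del: of_nat_add)
qed

text \<open>A particle on \<open>u\<^sub>k\<close> is routed by using only \<open>u\<^sub>1\<close>, ..., \<open>u\<^sub>k\<close>, until it reaches \<open>u\<^sub>0\<close> or \<open>u\<^sub>k\<^sub>+\<^sub>1\<close>;
  the two disjuncts are the resulting changes of \<open>g\<close>.\<close>

lemma particle_exit:
  assumes "k \<le> n" "\<rho> \<in> rotor_configs G"
  shows "\<exists>\<rho>'\<in>rotor_configs G. (\<forall>u>k. \<rho>' u = \<rho> u) \<and>
    (path_g n x y \<rho>' = path_g n x y \<rho> - H k \<or> path_g n x y \<rho>' = path_g n x y \<rho> + w k)"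
  using assms
proof (induction k arbitrary: \<rho>)
  case 0
  then show ?case by (auto simp: vertex_h_0)
next
  case (Suc k)
  have k: "Suc k \<in> {1..n}" using Suc.prems by simp
  have "\<rho> \<in> rotor_configs G \<Longrightarrow> \<exists>\<rho>'\<in>rotor_configs G. (\<forall>u>Suc k. \<rho>' u = \<rho> u) \<and>
    (path_g n x y \<rho>' = path_g n x y \<rho> - H (Suc k) \<or> path_g n x y \<rho>' = path_g n x y \<rho> + w (Suc k))"
    for \<rho>
  \<comment> \<open>The measure counts the left arcs still ahead before the rotor of
    \<open>Suc k\<close> points right; it drops with each excursion to the left that
    returns.\<close>
  proof (induction "if snd (\<rho> (Suc k)) < x then 0 else x + y - snd (\<rho> (Suc k))"
      arbitrary: \<rho> rule: less_induct)
    case less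
    define j where "j = snd (\<rho> (Suc k))"
    have j: "j < x + y"
      using less.prems k by (auto simp: j_def rotor_configs_iff)
    have jm: "int j mod N = int j"
      using j by (intro mod_pos_pos_trivial) auto
    define \<rho>\<^sub>1 where "\<rho>\<^sub>1 = \<rho>(Suc k := (Suc k, nat ((int j + 1) mod N)))"
    have \<rho>\<^sub>1: "\<rho>\<^sub>1 \<in> rotor_configs G"
      unfolding \<rho>\<^sub>1_def using less.prems k by (rule rotor_update)
    have g\<^sub>1: "path_g n x y \<rho>\<^sub>1 = path_g n x y \<rho> + (if j < x then w (Suc k) else - w k)"
      using path_g_update[OF less.prems k, of "int j + 1"] gval_step[of "Suc k" "int j"] jm
      by (simp add: \<rho>\<^sub>1_def j_def del: of_nat_add)
    show ?case
    proof (cases "j < x")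
      case True
      then show ?thesis
        using \<rho>\<^sub>1 g\<^sub>1 by (intro bexI[of _ \<rho>\<^sub>1]) (auto simp: \<rho>\<^sub>1_def)
    next
      case False
      \<comment> \<open>The particle has moved left to \<open>k\<close>. By the outer induction it
        ends at vertex 0 or returns to \<open>Suc k\<close>, whose rotor has meanwhile stayed
        put.\<close>
      obtain \<rho>\<^sub>2 where \<rho>\<^sub>2: "\<rho>\<^sub>2 \<in> rotor_configs G" "\<And>u. k < u \<Longrightarrow> \<rho>\<^sub>2 u = \<rho>\<^sub>1 u"
        and g\<^sub>2: "path_g n x y \<rho>\<^sub>2 = path_g n x y \<rho>\<^sub>1 - H k \<or> path_g n x y \<rho>\<^sub>2 = path_g n x y \<rho>\<^sub>1 + w k"
        using Suc.IH[OF _ \<rho>\<^sub>1] Suc.prems(1) by auto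
      have above: "\<rho>\<^sub>2 u = \<rho> u" if "Suc k < u" for u
        using that \<rho>\<^sub>2(2)[of u] by (simp add: \<rho>\<^sub>1_def)
      from g\<^sub>2 show ?thesis
      proof
        assume "path_g n x y \<rho>\<^sub>2 = path_g n x y \<rho>\<^sub>1 - H k"
        then have "path_g n x y \<rho>\<^sub>2 = path_g n x y \<rho> - H (Suc k)"
          using g\<^sub>1 False by (simp add: vertex_h_Suc)
        then show ?thesis
          using \<rho>\<^sub>2(1) above by blast
      next
        assume "path_g n x y \<rho>\<^sub>2 = path_g n x y \<rho>\<^sub>1 + w k"
        \<comment> \<open>A returning excursion changes g by \<open>- w k\<close> and then by
          \<open>w k\<close>, so nothing remains.\<close>
        then have g: "path_g n x y \<rho>\<^sub>2 = path_g n x y \<rho>"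
          using g\<^sub>1 False by simp
        have "int (snd (\<rho>\<^sub>2 (Suc k))) = (int j + 1) mod N"
          using \<rho>\<^sub>2(2)[of "Suc k"] nat_mod_N(2)[of "int j + 1"]
          by (simp add: \<rho>\<^sub>1_def del: of_nat_add int_nat_eq)
        also have "\<dots> = int ((j + 1) mod (x + y))"
          by (simp only: of_nat_mod of_nat_add of_nat_1)
        finally have "snd (\<rho>\<^sub>2 (Suc k)) = (j + 1) mod (x + y)"
          by (simp only: of_nat_eq_iff)
        also have "\<dots> = (if j + 1 = x + y then 0 else j + 1)"
          using j by simp
        finally have "(if snd (\<rho>\<^sub>2 (Suc k)) < x then 0 else x + y - snd (\<rho>\<^sub>2 (Suc k)))
            < (if snd (\<rho> (Suc k)) < x then 0 else x + y - snd (\<rho> (Suc k)))"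
          using False j x_pos by (auto simp: j_def)
        from less.hyps[OF this \<rho>\<^sub>2(1)] show ?thesis
          using g above by simp
      qed
    qed
  qed
  then show ?case using Suc.prems(2) .
qed

lemma zero_rotor: "(\<lambda>u\<in>{1..n}. (u, 0)) \<in> rotor_configs G"
  using x_pos by (simp add: rotor_configs_iff)

lemma path_g_mod_surj: "path_g_mod n x y ` rotor_configs G = {0..<int (path_order n x y)}"
proof
  show "path_g_mod n x y ` rotor_configs G \<subseteq> {0..<int (path_order n x y)}"
    using order_pos by (auto simp: path_g_mod_def)
next
  let ?F = "int (path_order n x y)"
  have step: "\<exists>\<rho>'\<in>rotor_configs G. path_g n x y \<rho>' mod ?F = (path_g n x y \<rho> + int y ^ n) mod ?F"
    if \<rho>: "\<rho> \<in> rotor_configs G" for \<rho>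
  proof -
    obtain \<rho>' where "\<rho>' \<in> rotor_configs G"
      "path_g n x y \<rho>' = path_g n x y \<rho> - H n \<or> path_g n x y \<rho>' = path_g n x y \<rho> + w n"
      using particle_exit[OF le_refl \<rho>] by blast
    \<comment> \<open>Leaving on the left changes g by \<open>int y ^ n\<close> minus F, leaving on
      the right by \<open>int y ^ n\<close>: the same residue.\<close>
    moreover have "path_g n x y \<rho> - H n = path_g n x y \<rho> + int y ^ n - ?F"
      by (simp add: vertex_h_n)
    moreover have "(path_g n x y \<rho> + int y ^ n - ?F) mod ?F = (path_g n x y \<rho> + int y ^ n) mod ?F"
      by simp
    moreover have "w n = int y ^ n"
      by (simp add: path_weight_def)
    ultimately show ?thesis
      by metis
  qed
  have multiple: "\<exists>\<rho>\<in>rotor_configs G. path_g n x y \<rho> mod ?F = (int i * int y ^ n) mod ?F" for i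
  proof (induction i)
    case 0
    have "path_g n x y (\<lambda>u\<in>{1..n}. (u, 0)) = 0"
      unfolding path_g_eq[OF zero_rotor] by (simp add: gval_def ups_0 downs_0)
    then show ?case
      using zero_rotor by (metis mod_0 mult_zero_left of_nat_0)
  next
    case (Suc i)
    then obtain \<rho> where \<rho>: "\<rho> \<in> rotor_configs G" "path_g n x y \<rho> mod ?F = (int i * int y ^ n) mod ?F"
      by blast
    obtain \<rho>' where "\<rho>' \<in> rotor_configs G" "path_g n x y \<rho>' mod ?F = (path_g n x y \<rho> + int y ^ n) mod ?F"
      using step[OF \<rho>(1)] by blast
    moreover have "(path_g n x y \<rho> + int y ^ n) mod ?F = (int i * int y ^ n + int y ^ n) mod ?F"
      using \<rho>(2) by (metis mod_add_left_eq)
    moreover have "int i * int y ^ n + int y ^ n = int (Suc i) * int y ^ n"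
      by (simp add: algebra_simps)
    ultimately show ?case
      by metis
  qed
  show "{0..<?F} \<subseteq> path_g_mod n x y ` rotor_configs G"
  proof
    fix m assume m: "m \<in> {0..<?F}"
    obtain a where "(a * int y ^ n) mod ?F = m mod ?F"
      using solve_mod_order by blast
    \<comment> \<open>Only nonnegative multiples have been reached, so \<open>a\<close> is replaced
      by its residue.\<close>
    then have "(int (nat (a mod ?F)) * int y ^ n) mod ?F = m"
      using m order_pos by (simp add: mod_mult_left_eq)
    then show "m \<in> path_g_mod n x y ` rotor_configs G"
      using multiple[of "nat (a mod ?F)"] unfolding path_g_mod_def by force
  qed
qed

section \<open>Quotients by rotor and sink equivalence, and the sandpile group\<close>

lemma path_h_nonsinks_zero:
  "\<forall>u\<in>{1..n}. \<sigma> u = 0 \<Longrightarrow> path_h n x y \<sigma> = \<sigma> (Suc n) * int (path_order n x y)"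
  unfolding path_h_eq sum_sinks by (simp add: vertex_h_0 vertex_h_last)

lemma path_h_mod_surj: "path_h_mod n x y ` particle_configs G = {0..<int (path_order n x y)}"
proof
  show "path_h_mod n x y ` particle_configs G \<subseteq> {0..<int (path_order n x y)}"
    using order_pos by (auto simp: path_h_mod_def)
next
  let ?F = "int (path_order n x y)"
  show "{0..<?F} \<subseteq> path_h_mod n x y ` particle_configs G"
  proof
    fix m assume m: "m \<in> {0..<?F}"
    obtain a where a: "(a * int y ^ n) mod ?F = m mod ?F"
      using solve_mod_order by blast
    \<comment> \<open>Modulo F, \<open>H n\<close> is the negative of the unit
      \<open>int y ^ n\<close>, hence \<open>- a\<close> particles on vertex
      \<open>n\<close>.\<close>
    define \<sigma> where "\<sigma> = (\<lambda>v\<in>{..Suc n}. if v = n then - a else 0)"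
    have "path_h n x y \<sigma> = (\<Sum>v\<le>Suc n. if v = n then - a * H n else 0)"
      unfolding path_h_eq by (rule sum.cong) (auto simp: \<sigma>_def)
    also have "\<dots> = - a * H n"
      by (simp del: sum.atMost_Suc)
    also have "\<dots> = a * int y ^ n + (- a) * ?F"
      by (simp add: vertex_h_n algebra_simps)
    finally have "path_h n x y \<sigma> mod ?F = m"
      using a m by (simp del: mult_minus_left)
    moreover have "\<sigma> \<in> particle_configs G"
      by (simp add: \<sigma>_def particle_configs_iff del: carrier_product_group)
    ultimately show "m \<in> path_h_mod n x y ` particle_configs G"
      by (force simp: path_h_mod_def)
  qed
qed

text \<open>With a common \<open>\<sigma>\<close>, h cancels in \<open>rp_equiv_iff\<close> and
  integer equality of g remains, which is congruence by \<open>path_g_mod_eq_iff\<close>.\<close>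

lemma rotor_equiv_eq:
  "rotor_equiv G = {(\<rho>, \<rho>'). \<rho> \<in> rotor_configs G \<and> \<rho>' \<in> rotor_configs G \<and>
     path_g_mod n x y \<rho> = path_g_mod n x y \<rho>'}"
proof -
  have "restrict (\<lambda>_. 0) {..Suc n} \<in> particle_configs G"
    by (simp add: particle_configs_iff del: carrier_product_group)
  then show ?thesis
    by (auto simp: rotor_equiv_def rp_equiv_iff rp_configs_def path_g_mod_eq_iff)
qed

lemma particle_equiv_iff:
  "(\<sigma>, \<sigma>') \<in> particle_equiv G \<longleftrightarrow> \<sigma> \<in> particle_configs G \<and> \<sigma>' \<in> particle_configs G \<and>
     (\<Sum>v\<le>Suc n. \<sigma> v) = (\<Sum>v\<le>Suc n. \<sigma>' v) \<and> path_h n x y \<sigma> = path_h n x y \<sigma>'"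
  using zero_rotor by (auto simp: particle_equiv_def rp_equiv_iff rp_configs_def)

text \<open>The sinks have h-values 0 and F, so changing their contents alters h exactly by
  multiples of F.\<close>

lemma sink_equiv_eq:
  "sink_equiv G = {(\<sigma>, \<sigma>'). \<sigma> \<in> particle_configs G \<and> \<sigma>' \<in> particle_configs G \<and>
     path_h_mod n x y \<sigma> = path_h_mod n x y \<sigma>'}"
proof -
  let ?F = "int (path_order n x y)"
  have "(\<exists>\<sigma>\<^sub>1. (\<sigma>, \<sigma>\<^sub>1) \<in> particle_equiv G \<and> (\<forall>u\<in>nonsinks G. \<sigma>\<^sub>1 u = \<sigma>' u)) \<longleftrightarrow>
      path_h_mod n x y \<sigma> = path_h_mod n x y \<sigma>'"
    if \<sigma>: "\<sigma> \<in> particle_configs G" "\<sigma>' \<in> particle_configs G" for \<sigma> \<sigma>'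
  proof
    assume "\<exists>\<sigma>\<^sub>1. (\<sigma>, \<sigma>\<^sub>1) \<in> particle_equiv G \<and> (\<forall>u\<in>nonsinks G. \<sigma>\<^sub>1 u = \<sigma>' u)"
    then obtain \<sigma>\<^sub>1 where "path_h n x y \<sigma> = path_h n x y \<sigma>\<^sub>1" "\<forall>u\<in>{1..n}. \<sigma>\<^sub>1 u = \<sigma>' u"
      by (auto simp: particle_equiv_iff nonsinks_path)
    then have "path_h n x y \<sigma> = path_h n x y \<sigma>' + (\<sigma>\<^sub>1 (Suc n) - \<sigma>' (Suc n)) * ?F"
      by (simp add: path_h_eq sum_sinks vertex_h_0 vertex_h_last algebra_simps del: sum.atMost_Suc)
    then show "path_h_mod n x y \<sigma> = path_h_mod n x y \<sigma>'"
      by (simp add: path_h_mod_def)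
  next
    assume "path_h_mod n x y \<sigma> = path_h_mod n x y \<sigma>'"
    then have "?F dvd path_h n x y \<sigma> - path_h n x y \<sigma>'"
      by (simp add: path_h_mod_def mod_eq_dvd_iff)
    then obtain t where t: "path_h n x y \<sigma> = path_h n x y \<sigma>' + t * ?F"
      by (metis add_diff_cancel_left' diff_add_cancel add.commute dvdE mult.commute)
    define s where "s = (\<Sum>v\<le>Suc n. \<sigma> v) - (\<Sum>v\<le>Suc n. \<sigma>' v)"
    \<comment> \<open>The \<open>t\<close> particles on the right sink correct h; the remaining
      \<open>s - t\<close> on the left sink correct the total without affecting h.\<close>
    define \<sigma>\<^sub>1 where "\<sigma>\<^sub>1 = \<sigma>'(0 := \<sigma>' 0 + (s - t), Suc n := \<sigma>' (Suc n) + t)"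
    have "\<sigma>\<^sub>1 \<in> particle_configs G"
      using \<sigma>(2) by (auto simp: particle_configs_iff \<sigma>\<^sub>1_def extensional_def simp del: carrier_product_group)
    moreover have "(\<Sum>v\<le>Suc n. \<sigma>\<^sub>1 v) = (\<Sum>v\<le>Suc n. \<sigma> v)"
      by (simp add: s_def sum_sinks \<sigma>\<^sub>1_def del: sum.atMost_Suc)
    moreover have "path_h n x y \<sigma>\<^sub>1 = path_h n x y \<sigma>"
      unfolding t unfolding path_h_eq sum_sinks
      by (simp add: \<sigma>\<^sub>1_def vertex_h_0 vertex_h_last algebra_simps)
    moreover have "\<forall>u\<in>nonsinks G. \<sigma>\<^sub>1 u = \<sigma>' u"
      by (simp add: nonsinks_path \<sigma>\<^sub>1_def)
    ultimately show "\<exists>\<sigma>\<^sub>1. (\<sigma>, \<sigma>\<^sub>1) \<in> particle_equiv G \<and> (\<forall>u\<in>nonsinks G. \<sigma>\<^sub>1 u = \<sigma>' u)"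
      using \<sigma>(1) by (intro exI[of _ \<sigma>\<^sub>1]) (simp add: particle_equiv_iff del: carrier_product_group)
  qed
  then show ?thesis
    unfolding sink_equiv_def by blast
qed

lemma path_h_mod_mult:
  assumes "\<sigma> \<in> particle_configs G" "\<tau> \<in> particle_configs G"
  shows "\<sigma> \<otimes>\<^bsub>particle_group G\<^esub> \<tau> \<in> particle_configs G"
    and "path_h_mod n x y (\<sigma> \<otimes>\<^bsub>particle_group G\<^esub> \<tau>) =
      path_h_mod n x y \<sigma> \<otimes>\<^bsub>integer_mod_group (path_order n x y)\<^esub> path_h_mod n x y \<tau>"
proof -
  have mult: "\<sigma> \<otimes>\<^bsub>particle_group G\<^esub> \<tau> = (\<lambda>v\<in>{..Suc n}. \<sigma> v + \<tau> v)"
    by (simp add: particle_group_def verts_path)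
  show "\<sigma> \<otimes>\<^bsub>particle_group G\<^esub> \<tau> \<in> particle_configs G"
    unfolding mult by (simp add: particle_configs_iff del: carrier_product_group)
  have "path_h n x y (\<sigma> \<otimes>\<^bsub>particle_group G\<^esub> \<tau>) = path_h n x y \<sigma> + path_h n x y \<tau>"
    unfolding mult path_h_eq sum.distrib[symmetric] by (rule sum.cong) (auto simp: distrib_right)
  then show "path_h_mod n x y (\<sigma> \<otimes>\<^bsub>particle_group G\<^esub> \<tau>) =
      path_h_mod n x y \<sigma> \<otimes>\<^bsub>integer_mod_group (path_order n x y)\<^esub> path_h_mod n x y \<tau>"
    by (simp add: path_h_mod_def mod_add_eq)
qed

lemma path_h_mod_one:
  "\<one>\<^bsub>particle_group G\<^esub> \<in> particle_configs G" "path_h_mod n x y \<one>\<^bsub>particle_group G\<^esub> = 0"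
proof -
  have one: "\<one>\<^bsub>particle_group G\<^esub> = (\<lambda>v\<in>{..Suc n}. 0)"
    by (simp add: particle_group_def verts_path)
  show "\<one>\<^bsub>particle_group G\<^esub> \<in> particle_configs G"
    unfolding one by (simp add: particle_configs_iff del: carrier_product_group)
  have "path_h n x y (\<lambda>v\<in>{..Suc n}. 0) = 0"
    unfolding path_h_eq by (rule sum.neutral) simp
  then show "path_h_mod n x y \<one>\<^bsub>particle_group G\<^esub> = 0"
    unfolding one by (simp add: path_h_mod_def)
qed

lemma sink_class_eq:
  assumes "\<sigma> \<in> particle_configs G" "\<sigma>' \<in> particle_configs G" "path_h_mod n x y \<sigma> = path_h_mod n x y \<sigma>'"
  shows "sink_equiv G `` {\<sigma>} = sink_equiv G `` {\<sigma>'}"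
  using assms unfolding sink_equiv_eq by auto

lemma sandpile_mult:
  assumes "\<sigma> \<in> particle_configs G" "\<tau> \<in> particle_configs G"
  shows "(sink_equiv G `` {\<sigma>}) \<otimes>\<^bsub>sandpile_group G\<^esub> (sink_equiv G `` {\<tau>}) =
    sink_equiv G `` {\<sigma> \<otimes>\<^bsub>particle_group G\<^esub> \<tau>}"
proof -
  have class_eq: "sink_equiv G `` {\<sigma>' \<otimes>\<^bsub>particle_group G\<^esub> \<tau>'} = sink_equiv G `` {\<sigma> \<otimes>\<^bsub>particle_group G\<^esub> \<tau>}"
    if "\<sigma>' \<in> sink_equiv G `` {\<sigma>}" "\<tau>' \<in> sink_equiv G `` {\<tau>}" for \<sigma>' \<tau>'
    using that assms by (intro sink_class_eq) (auto simp: sink_equiv_eq path_h_mod_mult)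
  have "\<sigma> \<in> sink_equiv G `` {\<sigma>}" "\<tau> \<in> sink_equiv G `` {\<tau>}"
    using assms by (auto simp: sink_equiv_eq)
  from UN_UN_eq_const[OF this class_eq] show ?thesis
    by (simp only: sandpile_group_def monoid.simps)
qed

lemma sandpile_iso:
  "\<exists>\<phi>\<in>iso (sandpile_group G) (integer_mod_group (path_order n x y)).
     group (sandpile_group G) \<and> (\<forall>\<sigma>\<in>particle_configs G. \<phi> (sink_equiv G `` {\<sigma>}) = path_h_mod n x y \<sigma>)"
proof -
  let ?S = "sandpile_group G" and ?Z = "integer_mod_group (path_order n x y)"
  have carrier: "carrier ?S = particle_configs G // sink_equiv G"
    and one: "\<one>\<^bsub>?S\<^esub> = sink_equiv G `` {\<one>\<^bsub>particle_group G\<^esub>}"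
    by (simp_all add: sandpile_group_def)
  have Z: "carrier ?Z = {0..<int (path_order n x y)}"
    using order_pos by (simp add: carrier_integer_mod_group)
  obtain \<phi> where bij: "bij_betw \<phi> (carrier ?S) (carrier ?Z)"
    and \<phi>: "\<And>\<sigma>. \<sigma> \<in> particle_configs G \<Longrightarrow> \<phi> (sink_equiv G `` {\<sigma>}) = path_h_mod n x y \<sigma>"
    using ex_bij_betw_quotient_kernel[OF sink_equiv_eq path_h_mod_surj] unfolding carrier Z by blast
  have mult: "a \<otimes>\<^bsub>?S\<^esub> b \<in> carrier ?S \<and> \<phi> (a \<otimes>\<^bsub>?S\<^esub> b) = \<phi> a \<otimes>\<^bsub>?Z\<^esub> \<phi> b"
    if mem: "a \<in> carrier ?S" "b \<in> carrier ?S" for a b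
  proof -
    obtain \<sigma> \<tau> where \<sigma>: "\<sigma> \<in> particle_configs G" "\<tau> \<in> particle_configs G"
      and ab: "a = sink_equiv G `` {\<sigma>}" "b = sink_equiv G `` {\<tau>}"
      using mem[unfolded carrier] by (elim quotientE) blast
    show ?thesis
      unfolding ab sandpile_mult[OF \<sigma>] carrier using \<sigma> path_h_mod_mult[OF \<sigma>]
      by (auto simp: \<phi> intro!: quotientI simp del: carrier_product_group mult_integer_mod_group)
  qed
  have "\<one>\<^bsub>?S\<^esub> \<in> carrier ?S" "\<phi> \<one>\<^bsub>?S\<^esub> = \<one>\<^bsub>?Z\<^esub>"
    unfolding one carrier using path_h_mod_one by (auto simp: \<phi> intro!: quotientI)
  then have "group ?S"
    using mult by (intro group_of_bij_hom[OF group_integer_mod_group bij]) auto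
  moreover have "\<phi> \<in> iso ?S ?Z"
    using mult bij bij_betwE[OF bij] by (auto simp: iso_def hom_def)
  ultimately show ?thesis
    using \<phi> by blast
qed

end

theorem theorem6:
  fixes n x y :: nat
  assumes "1 \<le> n" and "coprime x y" and "1 \<le> x" and "x < y"
  defines "G \<equiv> path_graph n x y"
    and "F \<equiv> path_order n x y"
    and "hbar \<equiv> path_h_mod n x y"
    and "gbar \<equiv> path_g_mod n x y"
  shows "(group (sandpile_group G) \<and> cyclic_group (sandpile_group G) \<and>
      Coset.order (sandpile_group G) = F) \<and>
    (hbar respects sink_equiv G \<and>
      (\<exists>\<phi> \<in> iso (sandpile_group G) (integer_mod_group F).
         \<forall>\<sigma> \<in> particle_configs G. \<phi> (sink_equiv G `` {\<sigma>}) = hbar \<sigma>)) \<and>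
    (gbar respects rotor_equiv G \<and>
      (\<exists>\<psi>. bij_betw \<psi> (rotor_configs G // rotor_equiv G) (carrier (integer_mod_group F)) \<and>
         (\<forall>\<rho> \<in> rotor_configs G. \<psi> (rotor_equiv G `` {\<rho>}) = gbar \<rho>))) \<and>
    (\<forall>\<rho> \<in> rotor_configs G. \<forall>\<sigma> \<in> particle_configs G.
      \<forall>(\<rho>', \<sigma>') \<in> routing_infty G (\<rho>, \<sigma>).
        gbar \<rho>' = gbar \<rho> \<otimes>\<^bsub>integer_mod_group F\<^esub> inv\<^bsub>integer_mod_group F\<^esub> hbar \<sigma>)"
proof -
  interpret path_rotor n x y
    using assms by unfold_locales auto
  have Z: "carrier (integer_mod_group F) = {0..<int F}"
    using order_pos by (simp add: carrier_integer_mod_group F_def)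
  obtain \<phi> where iso: "\<phi> \<in> iso (sandpile_group G) (integer_mod_group F)"
    and group: "group (sandpile_group G)"
    and \<phi>: "\<forall>\<sigma> \<in> particle_configs G. \<phi> (sink_equiv G `` {\<sigma>}) = hbar \<sigma>"
    using sandpile_iso unfolding G_def F_def hbar_def by blast
  have "cyclic_group (sandpile_group G)"
    using isomorphic_group_cyclicity[OF is_isoI[OF iso] group group_integer_mod_group]
      cyclic_integer_mod_group by blast
  moreover have "Coset.order (sandpile_group G) = F"
  proof -
    have "card (carrier (sandpile_group G)) = card {0..<int F}"
      using iso Z by (intro bij_betw_same_card[of \<phi>]) (simp add: iso_def)
    then show ?thesis
      by (simp add: Coset.order_def)
  qed
  moreover have "hbar respects sink_equiv G"
    unfolding hbar_def G_def sink_equiv_eq by (auto simp: congruent_def)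
  moreover have "gbar respects rotor_equiv G"
    unfolding gbar_def G_def rotor_equiv_eq by (auto simp: congruent_def)
  moreover have "\<exists>\<psi>. bij_betw \<psi> (rotor_configs G // rotor_equiv G) (carrier (integer_mod_group F)) \<and>
         (\<forall>\<rho> \<in> rotor_configs G. \<psi> (rotor_equiv G `` {\<rho>}) = gbar \<rho>)"
    using ex_bij_betw_quotient_kernel[OF rotor_equiv_eq path_g_mod_surj]
    unfolding Z unfolding G_def F_def gbar_def .
  moreover have "gbar \<rho>' = gbar \<rho> \<otimes>\<^bsub>integer_mod_group F\<^esub> inv\<^bsub>integer_mod_group F\<^esub> hbar \<sigma>"
    if "(\<rho>', \<sigma>') \<in> routing_infty G (\<rho>, \<sigma>)" for \<rho> \<sigma> \<rho>' \<sigma>'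
  proof -
    \<comment> \<open>The difference g - h is conserved, and the final particles lie on sinks, so
      their h is a multiple of F.\<close>
    have "path_g n x y \<rho> - path_h n x y \<sigma> = path_g n x y \<rho>' - path_h n x y \<sigma>'"
      and "\<forall>u\<in>{1..n}. \<sigma>' u = 0"
      using that unfolding G_def routing_infty_def by (auto simp: rp_equiv_iff nonsinks_path)
    then have "path_g n x y \<rho>' = path_g n x y \<rho> - path_h n x y \<sigma> + \<sigma>' (Suc n) * int F"
      using path_h_nonsinks_zero[of \<sigma>'] by (simp add: F_def)
    then have "gbar \<rho>' = (path_g n x y \<rho> - path_h n x y \<sigma>) mod int F"
      by (simp add: gbar_def path_g_mod_def F_def)
    moreover have "hbar \<sigma> \<in> carrier (integer_mod_group F)"
      using order_pos unfolding Z by (simp add: hbar_def path_h_mod_def F_def)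
    ultimately show ?thesis
      by (simp add: gbar_def hbar_def path_g_mod_def path_h_mod_def F_def mod_simps)
  qed
  ultimately show ?thesis
    using group iso \<phi> by blast
qed

end
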